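(* Let $(A,\cdot_A,[-,-]_A)$ be an $F$-manifold algebra and $\mathcal{B}:A\to A$ a Rota-Baxter operator (of weight zero) on $A$. Define new operations on $A$ by $$x\diamond y=\mathcal{B}(x)\cdot_A y,\qquad x\ast y=[\mathcal{B}(x),y]_A.$$ Then $(A,\diamond,\ast)$ is a pre-$F$-manifold algebra and $\mathcal{B}$ is a homomorphism of $F$-manifold algebras from the sub-adjacent $F$-manifold algebra $(A,\cdot_{\mathcal{B}},[-,-]_{\mathcal{B}})$ to $(A,\cdot_A,[-,-]_A)$, where $x\cdot_{\mathcal{B}}y=x\diamond y+y\diamond x$ and $[x,y]_{\mathcal{B}}=x\ast y-y\ast x$.
   Context: All vector spaces are finite dimensional over an algebraically closed field $\mathbb{K}$ of characteristic $0$. An $F$-manifold algebra is a triple $(A,\cdot_A,[-,-]_A)$ where $(A,\cdot_A)$ is a commutative associative algebra and $(A,[-,-]_A)$ is a Lie algebra such that $P_{x\cdot_A y}(z,w)=x\cdot_A P_y(z,w)+y\cdot_A P_x(z,w)$ for all $x,y,z,w\in A$, where $P_x(y,z)=[x,y\cdot_A z]_A-[x,y]_A\cdot_A z-y\cdot_A[x,z]_A$. A homomorphism of $F$-manifold algebras is a linear map preserving both the product and the bracket. A Rota-Baxter operator (of weight zero) on $A$ is a linear map $\mathcal{B}:A\to A$ with $\mathcal{B}(x)\cdot_A\mathcal{B}(y)=\mathcal{B}(\mathcal{B}(x)\cdot_A y+x\cdot_A\mathcal{B}(y))$ and $[\mathcal{B}(x),\mathcal{B}(y)]_A=\mathcal{B}([\mathcal{B}(x),y]_A+[x,\mathcal{B}(y)]_A)$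 for all $x,y\in A$. A Zinbiel algebra is a vector space with a bilinear product $\diamond$ such that $x\diamond(y\diamond z)=(y\diamond x)\diamond z+(x\diamond y)\diamond z$. A pre-Lie algebra is a vector space with a bilinear product $\ast$ such that $(x\ast y)\ast z-x\ast(y\ast z)=(y\ast x)\ast z-y\ast(x\ast z)$. A pre-$F$-manifold algebra is a triple $(B,\diamond,\ast)$ with $(B,\diamond)$ a Zinbiel algebra and $(B,\ast)$ a pre-Lie algebra such that, for all $x,y,z,w\in B$, $$F_1(x\cdot y,z,w)=x\diamond F_1(y,z,w)+y\diamond F_1(x,z,w),$$ $$(F_1(x,y,z)+F_1(x,z,y)+F_2(y,z,x))\diamond w=F_2(y,z,x\diamond w)-x\diamond F_2(y,z,w),$$ where $x\cdot y=x\diamond y+y\diamond x$, $[x,y]=x\ast y-y\ast x$, $F_1(x,y,z)=x\ast(y\diamond z)-y\diamond(x\ast z)-[x,y]\diamond z$ and $F_2(x,y,z)=x\diamond(y\ast z)+y\diamond(x\ast z)-(x\cdot y)\ast z$. Its sub-adjacent $F$-manifold algebra is $(B,\cdot,[-,-])$ with these $\cdot$ and $[-,-]$. *)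

theory Defs
  imports Complex_Main "HOL-Computational_Algebra.Polynomial"
begin

text \<open>
  A vector space is a whole type \<open>'a\<close> with a scalar multiplication \<open>scale\<close>.  The standing
  assumptions (algebraically closed ground field of characteristic 0, finite dimension) are part of
  the following locale, and hence of every algebra below.
\<close>

locale bilinear_product = vector_space scale
  for scale :: "'k::{alg_closed_field, field_char_0} \<Rightarrow> 'a::ab_group_add \<Rightarrow> 'a" +
  fixes prd :: "'a \<Rightarrow> 'a \<Rightarrow> 'a"
  assumes finite_dim: "\<exists>Basis. finite_dimensional_vector_space scale Basis"
    and linear_right: "Vector_Spaces.linear scale scale (\<lambda>y. prd x y)"
    and linear_left: "Vector_Spaces.linear scale scale (\<lambda>x. prd x y)"

locale comm_assoc_algebra = bilinear_product scale mul
  for scale :: "'k::{alg_closed_field, field_char_0} \<Rightarrow> 'a::ab_group_add \<Rightarrow> 'a"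
    and mul :: "'a \<Rightarrow> 'a \<Rightarrow> 'a"  (infixl \<open>\<cdot>\<close> 70) +
  assumes mult_assoc: "(x \<cdot> y) \<cdot> z = x \<cdot> (y \<cdot> z)"
    and mult_comm: "x \<cdot> y = y \<cdot> x"

locale lie_algebra = bilinear_product scale brk
  for scale :: "'k::{alg_closed_field, field_char_0} \<Rightarrow> 'a::ab_group_add \<Rightarrow> 'a"
    and brk :: "'a \<Rightarrow> 'a \<Rightarrow> 'a" +
  assumes alternating: "brk x x = 0"
    and jacobi: "brk x (brk y z) + brk y (brk z x) + brk z (brk x y) = 0"

definition leibnizator :: "('a \<Rightarrow> 'a \<Rightarrow> 'a) \<Rightarrow> ('a \<Rightarrow> 'a \<Rightarrow> 'a) \<Rightarrow> 'a \<Rightarrow> 'a \<Rightarrow> 'a \<Rightarrow> 'a::ab_group_add"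
  where "leibnizator mul brk x y z = brk x (mul y z) - mul (brk x y) z - mul y (brk x z)"

locale F_manifold_algebra = comm_assoc_algebra scale mul + lie_algebra scale brk
  for scale :: "'k::{alg_closed_field, field_char_0} \<Rightarrow> 'a::ab_group_add \<Rightarrow> 'a"
    and mul :: "'a \<Rightarrow> 'a \<Rightarrow> 'a"  (infixl \<open>\<cdot>\<close> 70)
    and brk :: "'a \<Rightarrow> 'a \<Rightarrow> 'a" +
  assumes hertling_manin:
    "leibnizator mul brk (x \<cdot> y) z w = x \<cdot> leibnizator mul brk y z w + y \<cdot> leibnizator mul brk x z w"

locale F_manifold_algebra_hom =
    dom: F_manifold_algebra scale1 mul1 brk1 + cod: F_manifold_algebra scale2 mul2 brk2 +
    Vector_Spaces.linear scale1 scale2 f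
  for scale1 :: "'k::{alg_closed_field, field_char_0} \<Rightarrow> 'a::ab_group_add \<Rightarrow> 'a"
    and mul1 brk1 :: "'a \<Rightarrow> 'a \<Rightarrow> 'a"
    and scale2 :: "'k \<Rightarrow> 'b::ab_group_add \<Rightarrow> 'b"
    and mul2 brk2 :: "'b \<Rightarrow> 'b \<Rightarrow> 'b"
    and f :: "'a \<Rightarrow> 'b" +
  assumes hom_mult: "f (mul1 x y) = mul2 (f x) (f y)"
    and hom_brk: "f (brk1 x y) = brk2 (f x) (f y)"

locale rota_baxter_operator =
    F_manifold_algebra scale mul brk + Vector_Spaces.linear scale scale B
  for scale :: "'k::{alg_closed_field, field_char_0} \<Rightarrow> 'a::ab_group_add \<Rightarrow> 'a"
    and mul :: "'a \<Rightarrow> 'a \<Rightarrow> 'a"  (infixl \<open>\<cdot>\<close> 70)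
    and brk :: "'a \<Rightarrow> 'a \<Rightarrow> 'a"
    and B :: "'a \<Rightarrow> 'a" +
  assumes rb_mult: "B x \<cdot> B y = B (B x \<cdot> y + x \<cdot> B y)"
    and rb_brk: "brk (B x) (B y) = B (brk (B x) y + brk x (B y))"

locale zinbiel_algebra = bilinear_product scale zin
  for scale :: "'k::{alg_closed_field, field_char_0} \<Rightarrow> 'a::ab_group_add \<Rightarrow> 'a"
    and zin :: "'a \<Rightarrow> 'a \<Rightarrow> 'a"  (infixl \<open>\<diamond>\<close> 70) +
  assumes zinbiel: "x \<diamond> (y \<diamond> z) = (y \<diamond> x) \<diamond> z + (x \<diamond> y) \<diamond> z"

locale pre_lie_algebra = bilinear_product scale pl
  for scale :: "'k::{alg_closed_field, field_char_0} \<Rightarrow> 'a::ab_group_add \<Rightarrow> 'a"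
    and pl :: "'a \<Rightarrow> 'a \<Rightarrow> 'a"  (infixl \<open>\<star>\<close> 70) +
  assumes pre_lie: "(x \<star> y) \<star> z - x \<star> (y \<star> z) = (y \<star> x) \<star> z - y \<star> (x \<star> z)"

definition subadj_mult :: "('a \<Rightarrow> 'a \<Rightarrow> 'a) \<Rightarrow> 'a \<Rightarrow> 'a \<Rightarrow> 'a::ab_group_add"
  where "subadj_mult zin x y = zin x y + zin y x"

definition subadj_brk :: "('a \<Rightarrow> 'a \<Rightarrow> 'a) \<Rightarrow> 'a \<Rightarrow> 'a \<Rightarrow> 'a::ab_group_add"
  where "subadj_brk pl x y = pl x y - pl y x"

definition F1 :: "('a \<Rightarrow> 'a \<Rightarrow> 'a) \<Rightarrow> ('a \<Rightarrow> 'a \<Rightarrow> 'a) \<Rightarrow> 'a \<Rightarrow> 'a \<Rightarrow> 'a \<Rightarrow> 'a::ab_group_add"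
  where "F1 zin pl x y z = pl x (zin y z) - zin y (pl x z) - zin (subadj_brk pl x y) z"

definition F2 :: "('a \<Rightarrow> 'a \<Rightarrow> 'a) \<Rightarrow> ('a \<Rightarrow> 'a \<Rightarrow> 'a) \<Rightarrow> 'a \<Rightarrow> 'a \<Rightarrow> 'a \<Rightarrow> 'a::ab_group_add"
  where "F2 zin pl x y z = zin x (pl y z) + zin y (pl x z) - pl (subadj_mult zin x y) z"

locale pre_F_manifold_algebra = zinbiel_algebra scale zin + pre_lie_algebra scale pl
  for scale :: "'k::{alg_closed_field, field_char_0} \<Rightarrow> 'a::ab_group_add \<Rightarrow> 'a"
    and zin :: "'a \<Rightarrow> 'a \<Rightarrow> 'a"  (infixl \<open>\<diamond>\<close> 70)
    and pl :: "'a \<Rightarrow> 'a \<Rightarrow> 'a"  (infixl \<open>\<star>\<close> 70) +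
  assumes F1_mult:
      "F1 zin pl (subadj_mult zin x y) z w = x \<diamond> F1 zin pl y z w + y \<diamond> F1 zin pl x z w"
    and F1_F2:
      "(F1 zin pl x y z + F1 zin pl x z y + F2 zin pl y z x) \<diamond> w
        = F2 zin pl y z (x \<diamond> w) - x \<diamond> F2 zin pl y z w"

end

theory Submission
  imports Defs
begin

text \<open>
  Write \<open>P\<close> for the leibnizator of \<open>A\<close>.  The Rota--Baxter identities say that \<open>B\<close> maps the two
  sub-adjacent operations to the original ones, and turn the defects of the new operations into
  \<open>F1 x y z = P (B x) (B y) z\<close> and \<open>F2 x y z = P z (B x) (B y)\<close>.  The first pre-F-manifold identity
  is then the Hertling--Manin relation for \<open>B x \<cdot> B y\<close>.  The leibnizator of the sub-adjacent
  operations is \<open>F1 x y z + F1 x z y + F2 y z x\<close>, which \<open>B\<close> maps to \<open>P (B x) (B y) (B z)\<close>, so the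
  second identity is the Hertling--Manin relation for \<open>B x \<cdot> w\<close>.
\<close>

context bilinear_product
begin

lemma prd_distribs:
  "prd x (y + z) = prd x y + prd x z" "prd (x + y) z = prd x z + prd y z"
  "prd x (y - z) = prd x y - prd x z" "prd (x - y) z = prd x z - prd y z"
  "prd x (- y) = - prd x y" "prd (- x) y = - prd x y"
  "prd x 0 = 0" "prd 0 y = 0"
proof -
  interpret r: Vector_Spaces.linear scale scale "prd x" for x by (rule linear_right)
  interpret l: Vector_Spaces.linear scale scale "\<lambda>x. prd x y" for y by (rule linear_left)
  show "prd x (y + z) = prd x y + prd x z" "prd (x + y) z = prd x z + prd y z"
    "prd x (y - z) = prd x y - prd x z" "prd (x - y) z = prd x z - prd y z"
    "prd x (- y) = - prd x y" "prd (- x) y = - prd x y"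
    "prd x 0 = 0" "prd 0 y = 0"
    by (rule r.add l.add r.diff l.diff r.neg l.neg r.zero l.zero)+
qed

text \<open>The finite-dimensional space is shared by all products on it, so a new product only owes
  linearity in each argument.\<close>

lemma bilinear_productI:
  assumes "\<And>x. Vector_Spaces.linear scale scale (q x)"
    and "\<And>y. Vector_Spaces.linear scale scale (\<lambda>x. q x y)"
  shows "bilinear_product scale q"
  by (intro bilinear_product.intro bilinear_product_axioms.intro vector_space_axioms finite_dim assms)

lemma bilinear_product_swap: "bilinear_product scale (\<lambda>x y. prd y x)"
  by (intro bilinear_productI linear_left linear_right)

lemma bilinear_product_add:
  assumes "bilinear_product scale q"
  shows "bilinear_product scale (\<lambda>x y. prd x y + q x y)"
proof -
  interpret q: bilinear_product scale q by fact
  interpret vector_space_pair scale scale by unfold_locales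
  show ?thesis
    by (intro bilinear_productI linear_compose_add
        linear_left linear_right q.linear_left q.linear_right)
qed

lemma bilinear_product_diff:
  assumes "bilinear_product scale q"
  shows "bilinear_product scale (\<lambda>x y. prd x y - q x y)"
proof -
  interpret q: bilinear_product scale q by fact
  interpret vector_space_pair scale scale by unfold_locales
  show ?thesis
    by (intro bilinear_productI linear_compose_sub
        linear_left linear_right q.linear_left q.linear_right)
qed

lemma bilinear_product_compose_left:
  assumes "Vector_Spaces.linear scale scale f"
  shows "bilinear_product scale (\<lambda>x y. prd (f x) y)"
proof -
  interpret f: Vector_Spaces.linear scale scale f by fact
  interpret l: Vector_Spaces.linear scale scale "\<lambda>x. prd x y" for y by (rule linear_left)
  have "Vector_Spaces.linear scale scale (\<lambda>x. prd (f x) y)" for y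
    by unfold_locales (simp_all add: f.add f.scale l.add l.scale)
  then show ?thesis
    by (intro bilinear_productI linear_right)
qed

end

lemma (in lie_algebra) skew: "brk x y = - brk y x"
proof -
  have "0 = brk (x + y) (x + y)"
    by (simp only: alternating)
  also have "\<dots> = brk x y + brk y x"
    unfolding prd_distribs by (simp add: alternating)
  finally show ?thesis
    by (simp add: eq_neg_iff_add_eq_0)
qed

lemma (in zinbiel_algebra) comm_assoc_subadj_mult: "comm_assoc_algebra scale (subadj_mult zin)"
proof -
  \<comment> \<open>The right-hand side of \<open>zinbiel\<close> is symmetric in \<open>x\<close>
    and \<open>y\<close>, so left multiplications commute; this matches the two bracketings
    below.\<close>
  have swap: "x \<diamond> (y \<diamond> z) = y \<diamond> (x \<diamond> z)" for x y z
    by (simp add: zinbiel add.commute)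
  interpret s: bilinear_product scale "subadj_mult zin"
    using bilinear_product_add[OF bilinear_product_swap] by (simp add: subadj_mult_def[abs_def])
  show ?thesis
  proof unfold_locales
    fix x y z
    have "subadj_mult zin (subadj_mult zin x y) z = x \<diamond> (y \<diamond> z) + z \<diamond> (x \<diamond> y) + z \<diamond> (y \<diamond> x)"
      by (simp add: subadj_mult_def prd_distribs zinbiel[of x y z] algebra_simps)
    moreover have "subadj_mult zin x (subadj_mult zin y z) = x \<diamond> (y \<diamond> z) + x \<diamond> (z \<diamond> y) + y \<diamond> (z \<diamond> x)"
      by (simp add: subadj_mult_def prd_distribs zinbiel[of y z x] algebra_simps)
    ultimately show "subadj_mult zin (subadj_mult zin x y) z = subadj_mult zin x (subadj_mult zin y z)"
      by (simp add: swap[of z])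
  qed (simp add: subadj_mult_def add.commute)
qed

lemma (in pre_lie_algebra) lie_subadj_brk: "lie_algebra scale (subadj_brk pl)"
proof -
  interpret s: bilinear_product scale "subadj_brk pl"
    using bilinear_product_diff[OF bilinear_product_swap] by (simp add: subadj_brk_def[abs_def])
  show ?thesis
  proof unfold_locales
    fix x y z
    \<comment> \<open>A difference of two associators, zero by \<open>pre_lie\<close>; the twelve
      terms of the Jacobi sum regroup into its cyclic sum.\<close>
    let ?d = "\<lambda>x y z. ((y \<star> x) \<star> z - y \<star> (x \<star> z)) - ((x \<star> y) \<star> z - x \<star> (y \<star> z))"
    have "subadj_brk pl x (subadj_brk pl y z) + subadj_brk pl y (subadj_brk pl z x) +
        subadj_brk pl z (subadj_brk pl x y) = ?d x y z + ?d y z x + ?d z x y"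
      by (simp add: subadj_brk_def prd_distribs algebra_simps)
    also have "\<dots> = 0"
      by (simp only: pre_lie[of x y z] pre_lie[of y z x] pre_lie[of z x y]) simp
    finally show "subadj_brk pl x (subadj_brk pl y z) + subadj_brk pl y (subadj_brk pl z x) +
        subadj_brk pl z (subadj_brk pl x y) = 0" .
  qed (simp add: subadj_brk_def)
qed

context pre_F_manifold_algebra
begin

lemmas zin_distribs = bilinear_product.prd_distribs[OF zinbiel_algebra.axioms(1)[OF zinbiel_algebra_axioms]]
lemmas pl_distribs = bilinear_product.prd_distribs[OF pre_lie_algebra.axioms(1)[OF pre_lie_algebra_axioms]]

text \<open>Sort the expanded terms by their last factor: those ending in \<open>z\<close>,
  \<open>y\<close> and \<open>x\<close> form the three summands in turn.\<close>

lemma leibnizator_subadj: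
  "leibnizator (subadj_mult zin) (subadj_brk pl) x y z
    = F1 zin pl x y z + F1 zin pl x z y + F2 zin pl y z x"
  by (simp add: leibnizator_def F1_def F2_def subadj_mult_def subadj_brk_def
      zin_distribs pl_distribs algebra_simps)

lemma F_manifold_algebra_subadj: "F_manifold_algebra scale (subadj_mult zin) (subadj_brk pl)"
proof -
  interpret s: comm_assoc_algebra scale "subadj_mult zin" by (rule comm_assoc_subadj_mult)
  interpret l: lie_algebra scale "subadj_brk pl" by (rule lie_subadj_brk)
  have F2_add: "F2 zin pl z w (x + y) = F2 zin pl z w x + F2 zin pl z w y" for x y z w
    by (simp add: F2_def zin_distribs pl_distribs algebra_simps)
  \<comment> \<open>The second defining identity, read as the rule for moving a left factor out of
    \<open>F2\<close>.\<close>
  have F2_zin: "F2 zin pl y z (x \<diamond> w) = x \<diamond> F2 zin pl y z w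
      + leibnizator (subadj_mult zin) (subadj_brk pl) x y z \<diamond> w" for x y z w
    using F1_F2[of x y z w] by (simp add: leibnizator_subadj algebra_simps)
  show ?thesis
  proof unfold_locales
    fix x y z w
    let ?P = "leibnizator (subadj_mult zin) (subadj_brk pl)"
    have "?P (subadj_mult zin x y) z w
        = x \<diamond> F1 zin pl y z w + y \<diamond> F1 zin pl x z w + (x \<diamond> F1 zin pl y w z + y \<diamond> F1 zin pl x w z)
          + F2 zin pl z w (x \<diamond> y + y \<diamond> x)"
      by (simp only: leibnizator_subadj F1_mult) (simp add: subadj_mult_def)
    \<comment> \<open>Moving \<open>x\<close> and \<open>y\<close> out of \<open>F2\<close> yields
      both the \<open>F2\<close> parts of \<open>?P\<close> under left multiplication and the
      missing terms with \<open>?P\<close> as left factor.\<close>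
    also have "\<dots> = x \<diamond> ?P y z w + ?P x z w \<diamond> y + (y \<diamond> ?P x z w + ?P y z w \<diamond> x)"
      by (simp only: F2_add F2_zin) (simp add: leibnizator_subadj zin_distribs algebra_simps)
    finally show "?P (subadj_mult zin x y) z w
        = subadj_mult zin x (?P y z w) + subadj_mult zin y (?P x z w)"
      by (simp add: subadj_mult_def algebra_simps)
  qed
qed

end

context rota_baxter_operator
begin

abbreviation rb_zin :: "'a \<Rightarrow> 'a \<Rightarrow> 'a" where "rb_zin x y \<equiv> B x \<cdot> y"
abbreviation rb_pl :: "'a \<Rightarrow> 'a \<Rightarrow> 'a" where "rb_pl x y \<equiv> brk (B x) y"
abbreviation P :: "'a \<Rightarrow> 'a \<Rightarrow> 'a \<Rightarrow> 'a" where "P \<equiv> leibnizator mul brk"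

lemmas mul_distribs = bilinear_product.prd_distribs[OF comm_assoc_algebra.axioms(1)[OF comm_assoc_algebra_axioms]]
lemmas brk_distribs = bilinear_product.prd_distribs[OF lie_algebra.axioms(1)[OF lie_algebra_axioms]]

lemma B_subadj_mult: "B (subadj_mult rb_zin x y) = B x \<cdot> B y"
  by (simp add: subadj_mult_def rb_mult mult_comm[of "B y" x])

lemma B_subadj_brk: "B (subadj_brk rb_pl x y) = brk (B x) (B y)"
  by (simp add: subadj_brk_def rb_brk skew[of "B y" x])

lemma F1_rb: "F1 rb_zin rb_pl x y z = P (B x) (B y) z"
  by (simp add: F1_def leibnizator_def B_subadj_brk)

text \<open>Flipping each bracket so that \<open>z\<close> comes first absorbs the signs.\<close>

lemma F2_rb: "F2 rb_zin rb_pl x y z = P z (B x) (B y)"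
  by (simp add: F2_def leibnizator_def B_subadj_mult skew[of z] mult_comm[of _ "B y"] mul_distribs)

lemma zinbiel_rb: "zinbiel_algebra scale rb_zin"
proof -
  interpret bilinear_product scale rb_zin
    by (rule bilinear_product.bilinear_product_compose_left[OF comm_assoc_algebra.axioms(1)])
      unfold_locales
  show ?thesis
  proof unfold_locales
    fix x y z
    \<comment> \<open>Linearity of \<open>B\<close> collects the sum into \<open>B\<close> of a
      sub-adjacent product, that is \<open>B x \<cdot> B y\<close>; what remains is associativity of
      \<open>mul\<close>.\<close>
    have "rb_zin (rb_zin y x) z + rb_zin (rb_zin x y) z = rb_zin (subadj_mult rb_zin x y) z"
      by (simp add: subadj_mult_def add mul_distribs)
    then show "rb_zin x (rb_zin y z) = rb_zin (rb_zin y x) z + rb_zin (rb_zin x y) z"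
      by (simp add: B_subadj_mult mult_assoc)
  qed
qed

lemma pre_lie_rb: "pre_lie_algebra scale rb_pl"
proof -
  interpret bilinear_product scale rb_pl
    by (rule bilinear_product.bilinear_product_compose_left[OF lie_algebra.axioms(1)])
      unfold_locales
  show ?thesis
  proof unfold_locales
    fix x y z
    have "rb_pl (rb_pl x y) z - rb_pl (rb_pl y x) z = rb_pl (subadj_brk rb_pl x y) z"
      by (simp add: subadj_brk_def diff brk_distribs)
    also have "\<dots> = brk (brk (B x) (B y)) z"
      by (simp add: B_subadj_brk)
    \<comment> \<open>Jacobi: bracketing with \<open>[B x, B y]\<close> is the commutator of
      bracketing with \<open>B x\<close> and with \<open>B y\<close>.\<close>
    also have "\<dots> = rb_pl x (rb_pl y z) - rb_pl y (rb_pl x z)"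
      using jacobi[of "B x" "B y" z]
      by (simp add: skew[of z] brk_distribs algebra_simps)
    finally show "rb_pl (rb_pl x y) z - rb_pl x (rb_pl y z) = rb_pl (rb_pl y x) z - rb_pl y (rb_pl x z)"
      by (simp add: algebra_simps)
  qed
qed

lemma B_leibnizator: "B (P (B x) (B y) z + P (B x) (B z) y + P x (B y) (B z)) = P (B x) (B y) (B z)"
proof -
  \<comment> \<open>This is \<open>leibnizator_subadj\<close> for the new operations, expanded
    afresh because that lemma presupposes the pre-F-manifold identities still to be proved.\<close>
  have "P (B x) (B y) z + P (B x) (B z) y + P x (B y) (B z)
    = subadj_brk rb_pl x (subadj_mult rb_zin y z)
      - subadj_mult rb_zin (subadj_brk rb_pl x y) z - subadj_mult rb_zin y (subadj_brk rb_pl x z)"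
    unfolding F1_rb[symmetric] F2_rb[symmetric]
    by (simp add: F1_def F2_def subadj_mult_def subadj_brk_def add diff
        mul_distribs brk_distribs algebra_simps)
  then show ?thesis
    by (simp add: diff B_subadj_mult B_subadj_brk leibnizator_def)
qed

theorem pre_F_manifold_rb: "pre_F_manifold_algebra scale rb_zin rb_pl"
proof -
  interpret z: zinbiel_algebra scale rb_zin by (rule zinbiel_rb)
  interpret l: pre_lie_algebra scale rb_pl by (rule pre_lie_rb)
  show ?thesis
  proof unfold_locales
    fix x y z w
    show "F1 rb_zin rb_pl (subadj_mult rb_zin x y) z w
        = rb_zin x (F1 rb_zin rb_pl y z w) + rb_zin y (F1 rb_zin rb_pl x z w)"
      by (simp add: F1_rb B_subadj_mult hertling_manin)
    show "rb_zin (F1 rb_zin rb_pl x y z + F1 rb_zin rb_pl x z y + F2 rb_zin rb_pl y z x) w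
        = F2 rb_zin rb_pl y z (rb_zin x w) - rb_zin x (F2 rb_zin rb_pl y z w)"
      by (simp add: F1_rb F2_rb B_leibnizator hertling_manin mult_comm[of w])
  qed
qed

theorem hom_rb: "F_manifold_algebra_hom scale (subadj_mult rb_zin) (subadj_brk rb_pl) scale mul brk B"
proof -
  \<comment> \<open>The domain inherits its laws from the general sub-adjacent construction, so only
    the compatibility of \<open>B\<close> with the operations is left.\<close>
  interpret s: F_manifold_algebra scale "subadj_mult rb_zin" "subadj_brk rb_pl"
    by (rule pre_F_manifold_algebra.F_manifold_algebra_subadj[OF pre_F_manifold_rb])
  show ?thesis
    by unfold_locales (simp_all add: B_subadj_mult B_subadj_brk)
qed

end

theorem corollary4p21:
  fixes scale :: "'k::{alg_closed_field, field_char_0} \<Rightarrow> 'a::ab_group_add \<Rightarrow> 'a"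
    and mul brk zin pl :: "'a \<Rightarrow> 'a \<Rightarrow> 'a"
    and B :: "'a \<Rightarrow> 'a"
  assumes "F_manifold_algebra scale mul brk"
    and "rota_baxter_operator scale mul brk B"
    and "\<And>x y. zin x y = mul (B x) y"
    and "\<And>x y. pl x y = brk (B x) y"
  shows "pre_F_manifold_algebra scale zin pl \<and>
    F_manifold_algebra_hom scale (subadj_mult zin) (subadj_brk pl) scale mul brk B"
proof -
  have "zin = (\<lambda>x y. mul (B x) y)" "pl = (\<lambda>x y. brk (B x) y)"
    using assms(3,4) by (simp_all add: fun_eq_iff)
  then show ?thesis
    using rota_baxter_operator.pre_F_manifold_rb[OF assms(2)]
      rota_baxter_operator.hom_rb[OF assms(2)] by simp
qed

end
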